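(* Let $X$ be a set, $f:[0,1]^X\to[0,1]^X$ an MV-interior operator, and $\tau=\{\alpha\in[0,1]^X: f(\alpha)=\alpha\}$. Then there is a subquantale $D$ of $([0,1],\bigvee,\odot)$ such that $(X,\tau)$ is a $D$-laminated MV-space, and for every $\beta\in[0,1]^X$, $f(\beta)$ is the $\tau$-interior of $\beta$, i.e. $f(\beta)=\bigvee\{\gamma\in\tau:\gamma\le\beta\}$.
   Context: $[0,1]$ has $x\oplus y=\min\{1,x+y\}$, $x\odot y=\max\{0,x+y-1\}$; operations and order on $[0,1]^X$ are pointwise; a subquantale $D$ of $[0,1]$ is a subset closed under arbitrary sups and $\odot$. A $D$-laminated MV-space is $(X,\tau)$ with $\tau\subseteq[0,1]^X$ containing $\mathbf 1$, closed under arbitrary suprema, under $o\mapsto r\odot o$ for $r\in D$ (with $(r\odot o)(x)=r\odot o(x)$), and under binary $\odot,\oplus,\wedge$. A map $f:[0,1]^X\to[0,1]^X$ is an MV-interior operator if for all $\alpha,\beta$: (I1) $f(\mathbf 1)=\mathbf 1$; (I2) $f(\alpha)\le\alpha$; (I3) $f(f(\alpha))=f(\alpha)$; (I4) $f(\alpha)\wedge f(\beta)=f(\alpha\wedge\beta)$; (I5) $f(\alpha)\oplus f(\beta)\le f(\alpha\oplus\beta)$; (I6) $f(\alpha)\odot f(\beta)\le f(\alpha\odot\beta)$. *)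

theory Defs
  imports Complex_Main "HOL-Library.FuncSet"
begin

definition mv_plus :: "real \<Rightarrow> real \<Rightarrow> real" (infixl "\<oplus>" 65)
  where "x \<oplus> y = min 1 (x + y)"

definition mv_times :: "real \<Rightarrow> real \<Rightarrow> real" (infixl "\<odot>" 70)
  where "x \<odot> y = max 0 (x + y - 1)"

(* The supremum in the complete lattice [0,1].  Inserting 0 leaves the supremum of a nonempty
   subset of [0,1] unchanged and gives the empty set its supremum 0; the real-valued Sup {}
   is unspecified. *)
definition unit_Sup :: "real set \<Rightarrow> real"
  where "unit_Sup S = Sup (insert 0 S)"

definition subquantale :: "real set \<Rightarrow> bool"
  where "subquantale D \<longleftrightarrow>
    D \<subseteq> {0..1} \<and> (\<forall>S\<subseteq>D. unit_Sup S \<in> D) \<and> (\<forall>r\<in>D. \<forall>s\<in>D. r \<odot> s \<in> D)"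

(* [0,1]^X, for a possibly empty set X, as the set of extensional functions on X, so that equality
   of elements is equality of HOL functions. *)
definition cube :: "'a set \<Rightarrow> ('a \<Rightarrow> real) set"
  where "cube X = (X \<rightarrow>\<^sub>E {0..1})"

definition pw_le :: "'a set \<Rightarrow> ('a \<Rightarrow> real) \<Rightarrow> ('a \<Rightarrow> real) \<Rightarrow> bool"
  where "pw_le X \<alpha> \<beta> \<longleftrightarrow> (\<forall>x\<in>X. \<alpha> x \<le> \<beta> x)"

definition pw_one :: "'a set \<Rightarrow> 'a \<Rightarrow> real"
  where "pw_one X = (\<lambda>x\<in>X. 1)"

definition pw_plus :: "'a set \<Rightarrow> ('a \<Rightarrow> real) \<Rightarrow> ('a \<Rightarrow> real) \<Rightarrow> 'a \<Rightarrow> real"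
  where "pw_plus X \<alpha> \<beta> = (\<lambda>x\<in>X. \<alpha> x \<oplus> \<beta> x)"

definition pw_times :: "'a set \<Rightarrow> ('a \<Rightarrow> real) \<Rightarrow> ('a \<Rightarrow> real) \<Rightarrow> 'a \<Rightarrow> real"
  where "pw_times X \<alpha> \<beta> = (\<lambda>x\<in>X. \<alpha> x \<odot> \<beta> x)"

definition pw_min :: "'a set \<Rightarrow> ('a \<Rightarrow> real) \<Rightarrow> ('a \<Rightarrow> real) \<Rightarrow> 'a \<Rightarrow> real"
  where "pw_min X \<alpha> \<beta> = (\<lambda>x\<in>X. min (\<alpha> x) (\<beta> x))"

definition pw_scale :: "'a set \<Rightarrow> real \<Rightarrow> ('a \<Rightarrow> real) \<Rightarrow> 'a \<Rightarrow> real"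
  where "pw_scale X r \<alpha> = (\<lambda>x\<in>X. r \<odot> \<alpha> x)"

definition pw_Sup :: "'a set \<Rightarrow> ('a \<Rightarrow> real) set \<Rightarrow> 'a \<Rightarrow> real"
  where "pw_Sup X S = (\<lambda>x\<in>X. unit_Sup ((\<lambda>\<alpha>. \<alpha> x) ` S))"

definition laminated_mv_space :: "real set \<Rightarrow> 'a set \<Rightarrow> ('a \<Rightarrow> real) set \<Rightarrow> bool"
  where "laminated_mv_space D X \<tau> \<longleftrightarrow>
    \<tau> \<subseteq> cube X \<and>
    pw_one X \<in> \<tau> \<and>
    (\<forall>S\<subseteq>\<tau>. pw_Sup X S \<in> \<tau>) \<and>
    (\<forall>r\<in>D. \<forall>\<alpha>\<in>\<tau>. pw_scale X r \<alpha> \<in> \<tau>) \<and>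
    (\<forall>\<alpha>\<in>\<tau>. \<forall>\<beta>\<in>\<tau>. pw_times X \<alpha> \<beta> \<in> \<tau>) \<and>
    (\<forall>\<alpha>\<in>\<tau>. \<forall>\<beta>\<in>\<tau>. pw_plus X \<alpha> \<beta> \<in> \<tau>) \<and>
    (\<forall>\<alpha>\<in>\<tau>. \<forall>\<beta>\<in>\<tau>. pw_min X \<alpha> \<beta> \<in> \<tau>)"

definition mv_interior_operator ::
    "'a set \<Rightarrow> (('a \<Rightarrow> real) \<Rightarrow> ('a \<Rightarrow> real)) \<Rightarrow> bool"
  where "mv_interior_operator X f \<longleftrightarrow>
    f \<in> cube X \<rightarrow> cube X \<and>
    f (pw_one X) = pw_one X \<and>
    (\<forall>\<alpha>\<in>cube X. pw_le X (f \<alpha>) \<alpha>) \<and>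
    (\<forall>\<alpha>\<in>cube X. f (f \<alpha>) = f \<alpha>) \<and>
    (\<forall>\<alpha>\<in>cube X. \<forall>\<beta>\<in>cube X. pw_min X (f \<alpha>) (f \<beta>) = f (pw_min X \<alpha> \<beta>)) \<and>
    (\<forall>\<alpha>\<in>cube X. \<forall>\<beta>\<in>cube X. pw_le X (pw_plus X (f \<alpha>) (f \<beta>)) (f (pw_plus X \<alpha> \<beta>))) \<and>
    (\<forall>\<alpha>\<in>cube X. \<forall>\<beta>\<in>cube X. pw_le X (pw_times X (f \<alpha>) (f \<beta>)) (f (pw_times X \<alpha> \<beta>)))"

definition mv_interior :: "'a set \<Rightarrow> ('a \<Rightarrow> real) set \<Rightarrow> ('a \<Rightarrow> real) \<Rightarrow> 'a \<Rightarrow> real"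
  where "mv_interior X \<tau> \<beta> = pw_Sup X {\<gamma> \<in> \<tau>. pw_le X \<gamma> \<beta>}"

end

(*
  By (I4) f is monotone, so each fixed point below beta lies below f(beta), and f(beta) is itself
  such a fixed point. Since f is deflationary, a fixed point is an alpha with alpha <= f(alpha);
  monotonicity gives this for suprema, and (I4)-(I6) give it for the binary operations. Nothing is
  needed of D beyond lamination by 0 and 1, which holds because 0 is the supremum of the empty
  family: the subquantale {0, 1} always works.
*)
theory Submission imports Defs begin

lemma cube_I: "(\<And>x. x \<in> X \<Longrightarrow> 0 \<le> g x \<and> g x \<le> 1) \<Longrightarrow> (\<lambda>x\<in>X. g x) \<in> cube X"
  by (auto simp: cube_def)

lemma cube_D: "\<alpha> \<in> cube X \<Longrightarrow> x \<in> X \<Longrightarrow> 0 \<le> \<alpha> x \<and> \<alpha> x \<le> 1"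
  by (auto simp: cube_def)

text \<open>Members of \<open>cube X\<close> all take the value \<open>undefined\<close> outside
  \<open>X\<close>, so agreement on \<open>X\<close> is equality of HOL functions.\<close>

lemma cube_eqI:
  assumes "\<alpha> \<in> cube X" "\<beta> \<in> cube X" "\<And>x. x \<in> X \<Longrightarrow> \<alpha> x = \<beta> x"
  shows "\<alpha> = \<beta>"
  using assms unfolding cube_def by (rule PiE_ext)

lemma pw_le_antisym:
  assumes "\<alpha> \<in> cube X" "\<beta> \<in> cube X" "pw_le X \<alpha> \<beta>" "pw_le X \<beta> \<alpha>"
  shows "\<alpha> = \<beta>"
  using assms(1,2)
  by (rule cube_eqI) (use assms(3,4) in \<open>auto simp: pw_le_def intro: antisym\<close>)

lemma pw_one_in_cube: "pw_one X \<in> cube X"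
  unfolding pw_one_def by (rule cube_I) auto

lemma pw_plus_in_cube: "\<alpha> \<in> cube X \<Longrightarrow> \<beta> \<in> cube X \<Longrightarrow> pw_plus X \<alpha> \<beta> \<in> cube X"
  unfolding pw_plus_def by (rule cube_I) (auto simp: mv_plus_def dest!: cube_D)

lemma pw_times_in_cube:
  assumes "\<alpha> \<in> cube X" "\<beta> \<in> cube X"
  shows "pw_times X \<alpha> \<beta> \<in> cube X"
  unfolding pw_times_def
proof (rule cube_I)
  fix x assume "x \<in> X"
  then show "0 \<le> \<alpha> x \<odot> \<beta> x \<and> \<alpha> x \<odot> \<beta> x \<le> 1"
    using cube_D[OF assms(1)] cube_D[OF assms(2)] by (force simp: mv_times_def)
qed

lemma pw_min_in_cube: "\<alpha> \<in> cube X \<Longrightarrow> \<beta> \<in> cube X \<Longrightarrow> pw_min X \<alpha> \<beta> \<in> cube X"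
  unfolding pw_min_def by (rule cube_I) (auto dest!: cube_D)

text \<open>Recasts the order as an equation between meets, the form to which (I4) applies.\<close>

lemma pw_min_absorb1:
  assumes "\<alpha> \<in> cube X" "\<beta> \<in> cube X" "pw_le X \<alpha> \<beta>"
  shows "pw_min X \<alpha> \<beta> = \<alpha>"
  using pw_min_in_cube[OF assms(1,2)] assms(1)
  by (rule cube_eqI) (use assms(3) in \<open>auto simp: pw_min_def pw_le_def\<close>)

text \<open>The reals are only conditionally complete; the inclusion in \<open>{0..1}\<close>
  supplies the upper bound 1 for \<open>insert 0 S\<close>.\<close>

lemma unit_Sup_upper: "S \<subseteq> {0..1} \<Longrightarrow> x \<in> S \<Longrightarrow> x \<le> unit_Sup S"
  unfolding unit_Sup_def by (rule cSup_upper) (auto intro!: bdd_aboveI[of _ 1])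

text \<open>The assumption \<open>0 \<le> z\<close> takes care of the inserted 0, which is the whole
  supremum when \<open>S\<close> is empty.\<close>

lemma unit_Sup_least: "0 \<le> z \<Longrightarrow> (\<And>x. x \<in> S \<Longrightarrow> x \<le> z) \<Longrightarrow> unit_Sup S \<le> z"
  unfolding unit_Sup_def by (rule cSup_least) auto

lemma unit_Sup_nonneg:
  assumes "S \<subseteq> {0..1}"
  shows "0 \<le> unit_Sup S"
  unfolding unit_Sup_def
  by (rule cSup_upper) (use assms in \<open>auto intro!: bdd_aboveI[of _ 1]\<close>)

lemma eval_image_subset: "S \<subseteq> cube X \<Longrightarrow> x \<in> X \<Longrightarrow> (\<lambda>\<alpha>. \<alpha> x) ` S \<subseteq> {0..1}"
  using cube_D by fastforce

lemma pw_Sup_in_cube: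
  assumes "S \<subseteq> cube X"
  shows "pw_Sup X S \<in> cube X"
  unfolding pw_Sup_def
proof (rule cube_I)
  fix x assume "x \<in> X"
  then have "(\<lambda>\<alpha>. \<alpha> x) ` S \<subseteq> {0..1}"
    by (rule eval_image_subset[OF assms])
  then show "0 \<le> unit_Sup ((\<lambda>\<alpha>. \<alpha> x) ` S) \<and> unit_Sup ((\<lambda>\<alpha>. \<alpha> x) ` S) \<le> 1"
    by (auto intro!: unit_Sup_nonneg unit_Sup_least)
qed

lemma pw_Sup_upper: "S \<subseteq> cube X \<Longrightarrow> \<alpha> \<in> S \<Longrightarrow> pw_le X \<alpha> (pw_Sup X S)"
  by (auto simp: pw_le_def pw_Sup_def intro!: unit_Sup_upper dest: eval_image_subset)

lemma pw_Sup_least: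
  assumes "\<beta> \<in> cube X" "\<And>\<alpha>. \<alpha> \<in> S \<Longrightarrow> pw_le X \<alpha> \<beta>"
  shows "pw_le X (pw_Sup X S) \<beta>"
  using assms by (auto simp: pw_le_def pw_Sup_def cube_D intro!: unit_Sup_least)

text \<open>Both sides are the zero function on \<open>X\<close>: max 0 (a - 1) = 0 because a \<le>
  1, and the empty supremum is 0 by the inserted 0.\<close>

lemma pw_scale_0: "\<alpha> \<in> cube X \<Longrightarrow> pw_scale X 0 \<alpha> = pw_Sup X {}"
  by (auto simp: pw_scale_def pw_Sup_def mv_times_def unit_Sup_def dest: cube_D
      intro!: restrict_ext)

text \<open>1 is the unit of \<odot> on [0,1]: max 0 a = a because a \<ge> 0.\<close>

lemma pw_scale_1:
  assumes "\<alpha> \<in> cube X"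
  shows "pw_scale X 1 \<alpha> = \<alpha>"
proof -
  have eq: "1 \<odot> \<alpha> x = \<alpha> x" if "x \<in> X" for x
    using cube_D[OF assms that] by (simp add: mv_times_def)
  then have "pw_scale X 1 \<alpha> \<in> cube X"
    unfolding pw_scale_def by (intro cube_I) (simp add: cube_D[OF assms])
  then show ?thesis
    using assms by (rule cube_eqI) (simp add: pw_scale_def eq)
qed

lemma subquantale_0_1: "subquantale {0, 1}"
  unfolding subquantale_def
proof (intro conjI allI impI ballI)
  fix S :: "real set" assume S: "S \<subseteq> {0, 1}"
  show "unit_Sup S \<in> {0, 1}"
    \<comment> \<open>\<open>S\<close> is finite, so the supremum is a maximum, attained in
      \<open>insert 0 S\<close> and hence equal to 0 or 1.\<close>
    unfolding unit_Sup_def using S finite_subset[OF S] Max_in[of "insert 0 S"]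
    by (subst cSup_eq_Max) auto
qed (auto simp: mv_times_def)

theorem theorem5p5:
  fixes X :: "'a set"
    and f :: "('a \<Rightarrow> real) \<Rightarrow> ('a \<Rightarrow> real)"
    and \<tau> :: "('a \<Rightarrow> real) set"
  assumes "mv_interior_operator X f"
    and "\<tau> = {\<alpha> \<in> cube X. f \<alpha> = \<alpha>}"
  shows "(\<exists>D. subquantale D \<and> laminated_mv_space D X \<tau>) \<and>
    (\<forall>\<beta>\<in>cube X. f \<beta> = mv_interior X \<tau> \<beta>)"
proof -
  have f_cube: "f \<alpha> \<in> cube X" if "\<alpha> \<in> cube X" for \<alpha>
    using assms(1) that by (auto simp: mv_interior_operator_def)
  have f_one: "f (pw_one X) = pw_one X"
    using assms(1) by (simp add: mv_interior_operator_def)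
  have f_le: "pw_le X (f \<alpha>) \<alpha>" and f_idem: "f (f \<alpha>) = f \<alpha>" if "\<alpha> \<in> cube X" for \<alpha>
    using assms(1) that by (simp_all add: mv_interior_operator_def)
  have f_min: "pw_min X (f \<alpha>) (f \<beta>) = f (pw_min X \<alpha> \<beta>)"
    and f_plus: "pw_le X (pw_plus X (f \<alpha>) (f \<beta>)) (f (pw_plus X \<alpha> \<beta>))"
    and f_times: "pw_le X (pw_times X (f \<alpha>) (f \<beta>)) (f (pw_times X \<alpha> \<beta>))"
    if "\<alpha> \<in> cube X" "\<beta> \<in> cube X" for \<alpha> \<beta>
    using assms(1) that by (simp_all add: mv_interior_operator_def)
  have mono: "pw_le X (f \<alpha>) (f \<beta>)" if "\<alpha> \<in> cube X" "\<beta> \<in> cube X" "pw_le X \<alpha> \<beta>" for \<alpha> \<beta>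
  proof -
    \<comment> \<open>Apply \<open>f\<close> to \<alpha> = \<alpha> \<and> \<beta> and split the
      right-hand side by (I4).\<close>
    have "f \<alpha> = pw_min X (f \<alpha>) (f \<beta>)"
      using that by (simp add: f_min pw_min_absorb1)
    moreover have "pw_le X (pw_min X (f \<alpha>) (f \<beta>)) (f \<beta>)"
      by (simp add: pw_le_def pw_min_def)
    ultimately show ?thesis by simp
  qed
  have \<tau>_cube: "\<tau> \<subseteq> cube X" and \<tau>_fix: "\<And>\<alpha>. \<alpha> \<in> \<tau> \<Longrightarrow> f \<alpha> = \<alpha>"
    using assms(2) by auto
  \<comment> \<open>The reverse inequality is (I2), so membership in \<tau> only requires \<alpha>
    \<le> f(\<alpha>).\<close>
  have \<tau>_I: "\<alpha> \<in> \<tau>" if "\<alpha> \<in> cube X" "pw_le X \<alpha> (f \<alpha>)" for \<alpha>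
    using pw_le_antisym[OF f_cube that(1) f_le] that assms(2) by simp
  have Sup_\<tau>: "pw_Sup X S \<in> \<tau>" if "S \<subseteq> \<tau>" for S
  proof (rule \<tau>_I)
    have S: "S \<subseteq> cube X" using that \<tau>_cube by blast
    show cube: "pw_Sup X S \<in> cube X" by (rule pw_Sup_in_cube[OF S])
    show "pw_le X (pw_Sup X S) (f (pw_Sup X S))"
    proof (rule pw_Sup_least[OF f_cube[OF cube]])
      fix \<alpha> assume "\<alpha> \<in> S"
      \<comment> \<open>\<alpha> = f(\<alpha>) \<le> f(sup S), by monotonicity and \<alpha> \<le>
        sup S.\<close>
      then show "pw_le X \<alpha> (f (pw_Sup X S))"
        using mono[of \<alpha> "pw_Sup X S"] S cube pw_Sup_upper[OF S] \<tau>_fix[of \<alpha>] that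
        by (auto simp: subset_iff)
    qed
  qed
  have "laminated_mv_space {0, 1} X \<tau>"
    unfolding laminated_mv_space_def
  proof (intro conjI allI impI ballI)
    show "\<tau> \<subseteq> cube X" by (rule \<tau>_cube)
    show "pw_one X \<in> \<tau>" using assms(2) f_one pw_one_in_cube by auto
    show "pw_Sup X S \<in> \<tau>" if "S \<subseteq> \<tau>" for S by (rule Sup_\<tau>[OF that])
    \<comment> \<open>Scaling by 1 returns \<alpha>; scaling by 0 gives the supremum of the empty
      family, which \<open>Sup_\<tau>\<close> puts in \<tau>.\<close>
    show "pw_scale X r \<alpha> \<in> \<tau>" if "r \<in> {0, 1}" "\<alpha> \<in> \<tau>" for r \<alpha>
      using that \<tau>_cube Sup_\<tau>[of "{}"] by (auto simp: pw_scale_0 pw_scale_1 subset_iff)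
    fix \<alpha> \<beta> assume ab: "\<alpha> \<in> \<tau>" "\<beta> \<in> \<tau>"
    then have cube: "\<alpha> \<in> cube X" "\<beta> \<in> cube X" and fix_eq: "f \<alpha> = \<alpha>" "f \<beta> = \<beta>"
      using \<tau>_cube \<tau>_fix by auto
    \<comment> \<open>At fixed points (I6) reads \<alpha> \<odot> \<beta> \<le> f(\<alpha> \<odot>
      \<beta>), just what \<open>\<tau>_I\<close> asks for; (I5) does the same for \<oplus>. As (I4)
      is an equation, the meet is a fixed point directly.\<close>
    show "pw_times X \<alpha> \<beta> \<in> \<tau>"
      using f_times[OF cube] fix_eq by (intro \<tau>_I pw_times_in_cube cube) simp
    show "pw_plus X \<alpha> \<beta> \<in> \<tau>"
      using f_plus[OF cube] fix_eq by (intro \<tau>_I pw_plus_in_cube cube) simp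
    show "pw_min X \<alpha> \<beta> \<in> \<tau>"
      using f_min[OF cube] fix_eq pw_min_in_cube[OF cube] assms(2) by simp
  qed
  moreover have "f \<beta> = mv_interior X \<tau> \<beta>" if \<beta>: "\<beta> \<in> cube X" for \<beta>
  proof -
    let ?S = "{\<gamma> \<in> \<tau>. pw_le X \<gamma> \<beta>}"
    have S: "?S \<subseteq> cube X" using \<tau>_cube by auto
    \<comment> \<open>f(\<beta>) is a fixed point by (I3) and lies below \<beta> by (I2).\<close>
    have "f \<beta> \<in> ?S" using assms(2) f_cube f_le f_idem \<beta> by simp
    then have "pw_le X (f \<beta>) (pw_Sup X ?S)" by (rule pw_Sup_upper[OF S])
    \<comment> \<open>Each \<gamma> in the family satisfies \<gamma> = f(\<gamma>) \<le> f(\<beta>)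
      by monotonicity.\<close>
    moreover have "pw_le X (pw_Sup X ?S) (f \<beta>)"
      using mono[OF _ \<beta>] \<tau>_cube \<tau>_fix by (intro pw_Sup_least f_cube \<beta>) force
    ultimately show ?thesis
      unfolding mv_interior_def by (rule pw_le_antisym[OF f_cube[OF \<beta>] pw_Sup_in_cube[OF S]])
  qed
  ultimately show ?thesis using subquantale_0_1 by blast
qed

end
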